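(* Suppose $(\mathsf P,\mathsf{Opens})$ is an intertwined-complete quasiregular semitopology. Then: \begin{enumerate} \item For every $p\in\mathsf P$ there exists some regular $q\in K(p)$. \item $\mathsf P$ contains a regular point. \end{enumerate}
   Context: A semitopology is a pair $(\mathsf P,\mathsf{Opens})$ with $\mathsf{Opens}\subseteq\mathcal P(\mathsf P)$ containing $\varnothing$ and $\mathsf P$ and closed under arbitrary unions. Points $p,p'$ are intertwined when every open neighbourhood of $p$ intersects every open neighbourhood of $p'$; $p_{\between}$ denotes the set of points intertwined with $p$. $\mathrm{interior}(X)$ is the union of open sets contained in $X$. The community of $p$ is $K(p)=\mathrm{interior}(p_{\between})$. $p$ is quasiregular when $K(p)\neq\varnothing$, and the semitopology is quasiregular when every point is. $p$ is regular when $p\in K(p)$ and $K(p)$ is nonempty, open and transitive (for all open $O,O'$, if $O\cap K(p)\neq\varnothing$ and $K(p)\cap O'\neq\varnothing$ then $O\cap O'\neq\varnothing$). The intertwined preorder is $p\le p'$ when $p_{\between}\subseteq p'_{\between}$; the semitopology is intertwined-complete when for every subset $P\subseteq\mathsf P$ totally ordered by this preorder there exists $p\in\mathsf P$ with $p_{\between}\subseteq\bigcap\{p'_{\between}\mid p'\in P\}$. *)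

theory Defs
  imports Main
begin

definition semitopology :: "'a set \<Rightarrow> 'a set set \<Rightarrow> bool" where
  "semitopology P Opens \<longleftrightarrow>
     Opens \<subseteq> Pow P \<and> {} \<in> Opens \<and> P \<in> Opens \<and> (\<forall>\<O>. \<O> \<subseteq> Opens \<longrightarrow> \<Union>\<O> \<in> Opens)"

definition intertwined :: "'a set set \<Rightarrow> 'a \<Rightarrow> 'a \<Rightarrow> bool" where
  "intertwined Opens p p' \<longleftrightarrow>
     (\<forall>U\<in>Opens. \<forall>V\<in>Opens. p \<in> U \<and> p' \<in> V \<longrightarrow> U \<inter> V \<noteq> {})"

definition intertwined_set :: "'a set \<Rightarrow> 'a set set \<Rightarrow> 'a \<Rightarrow> 'a set" where
  "intertwined_set P Opens p = {p' \<in> P. intertwined Opens p p'}"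

definition semi_interior :: "'a set set \<Rightarrow> 'a set \<Rightarrow> 'a set" where
  "semi_interior Opens X = \<Union>{U \<in> Opens. U \<subseteq> X}"

definition community :: "'a set \<Rightarrow> 'a set set \<Rightarrow> 'a \<Rightarrow> 'a set" where
  "community P Opens p = semi_interior Opens (intertwined_set P Opens p)"

definition quasiregular_point :: "'a set \<Rightarrow> 'a set set \<Rightarrow> 'a \<Rightarrow> bool" where
  "quasiregular_point P Opens p \<longleftrightarrow> community P Opens p \<noteq> {}"

definition quasiregular :: "'a set \<Rightarrow> 'a set set \<Rightarrow> bool" where
  "quasiregular P Opens \<longleftrightarrow> (\<forall>p\<in>P. quasiregular_point P Opens p)"

definition transitive_set :: "'a set set \<Rightarrow> 'a set \<Rightarrow> bool" where
  "transitive_set Opens T \<longleftrightarrow>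
     (\<forall>U\<in>Opens. \<forall>V\<in>Opens. U \<inter> T \<noteq> {} \<and> T \<inter> V \<noteq> {} \<longrightarrow> U \<inter> V \<noteq> {})"

definition regular_point :: "'a set \<Rightarrow> 'a set set \<Rightarrow> 'a \<Rightarrow> bool" where
  "regular_point P Opens p \<longleftrightarrow>
     p \<in> community P Opens p \<and> community P Opens p \<noteq> {} \<and>
     community P Opens p \<in> Opens \<and> transitive_set Opens (community P Opens p)"

definition intertwined_le :: "'a set \<Rightarrow> 'a set set \<Rightarrow> 'a \<Rightarrow> 'a \<Rightarrow> bool" where
  "intertwined_le P Opens p p' \<longleftrightarrow> intertwined_set P Opens p \<subseteq> intertwined_set P Opens p'"

text \<open>The chain \<^term>\<open>C\<close> may be empty, in which case the intersection is \<^term>\<open>UNIV\<close> and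
  the condition just says that \<^term>\<open>P\<close> is nonempty.  Totality is that of a preorder: distinct
  members of \<^term>\<open>C\<close> may lie below each other.\<close>

definition intertwined_complete :: "'a set \<Rightarrow> 'a set set \<Rightarrow> bool" where
  "intertwined_complete P Opens \<longleftrightarrow>
     (\<forall>C. C \<subseteq> P \<and> Complete_Partial_Order.chain (intertwined_le P Opens) C \<longrightarrow>
        (\<exists>p\<in>P. intertwined_set P Opens p \<subseteq> (\<Inter>p'\<in>C. intertwined_set P Opens p')))"

end

theory Submission imports Defs begin

text \<open>Every point \<open>q\<close> of \<open>K(m)\<close> satisfies \<open>q \<le> m\<close> in the intertwined preorder. Hence, if \<open>m\<close> is
  minimal, all points of \<open>K(m)\<close> have the same intertwined set as \<open>m\<close>; so they are pairwise
  intertwined and share the community \<open>K(m)\<close>, i.e. they are regular. Completeness and the Hausdorff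
  maximality principle provide a minimal \<open>m \<le> p\<close>, and quasiregularity makes \<open>K(m) \<subseteq> K(p)\<close>
  nonempty.\<close>

definition minimal_wrt :: "('a \<Rightarrow> 'a \<Rightarrow> bool) \<Rightarrow> 'a set \<Rightarrow> 'a \<Rightarrow> bool" where
  "minimal_wrt R A m \<longleftrightarrow> m \<in> A \<and> (\<forall>x\<in>A. R x m \<longrightarrow> R m x)"

lemma preorder_minimal_below_if_chains_bounded:
  assumes refl: "reflp_on A R" and trans: "transp_on A R"
    and bounded: "\<And>C. \<lbrakk>C \<subseteq> A; Complete_Partial_Order.chain R C\<rbrakk> \<Longrightarrow> \<exists>b\<in>A. \<forall>c\<in>C. R b c"
    and a: "a \<in> A"
  obtains m where "minimal_wrt R A m" and "R m a"
proof -
  let ?B = "{x \<in> A. R x a}"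
  obtain M where M: "pred_on.maxchain ?B R M"
    using pred_on.Hausdorff by blast
  then have M_subset: "M \<subseteq> ?B"
    by (simp add: pred_on.maxchain_def pred_on.chain_def)
  have M_total: "R x y \<or> R y x" if "x \<in> M" "y \<in> M" for x y
    using M that M_subset reflp_onD[OF refl, of x]
    by (auto simp: pred_on.maxchain_def pred_on.chain_def)
  have "Complete_Partial_Order.chain R (insert a M)"
    using M_subset M_total reflp_onD[OF refl a] by (auto simp: chain_def)
  then obtain m where m: "m \<in> A" "R m a" and m_below: "\<forall>x\<in>M. R m x"
    using bounded[of "insert a M"] M_subset a by auto
  have "R m x" if x: "x \<in> A" "R x m" for x
  proof -
    have "x \<in> ?B"
      using transp_onD[OF trans x(1) m(1) a x(2) m(2)] x(1) by simp
    moreover have "\<forall>y\<in>M. R x y"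
      using transp_onD[OF trans x(1) m(1) _ x(2)] m_below M_subset by auto
    ultimately have "pred_on.chain ?B R (insert x M)"
      using M_subset M_total by (auto simp: pred_on.chain_def)
    with M have "x \<in> M"
      unfolding pred_on.maxchain_def by blast
    with m_below show "R m x" by blast
  qed
  with m that show thesis
    unfolding minimal_wrt_def by blast
qed

lemma semi_interior_subset: "semi_interior Opens X \<subseteq> X"
  by (auto simp: semi_interior_def)

lemma semi_interior_mono: "X \<subseteq> Y \<Longrightarrow> semi_interior Opens X \<subseteq> semi_interior Opens Y"
  by (auto simp: semi_interior_def)

lemma semi_interior_open:
  assumes "semitopology P Opens"
  shows "semi_interior Opens X \<in> Opens"
proof -
  have "{U \<in> Opens. U \<subseteq> X} \<subseteq> Opens" by blast
  with assms show ?thesis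
    unfolding semitopology_def semi_interior_def by blast
qed

lemma transitive_set_iff_pairwise_intertwined:
  "transitive_set Opens T \<longleftrightarrow> (\<forall>x\<in>T. \<forall>y\<in>T. intertwined Opens x y)"
  unfolding transitive_set_def intertwined_def by blast

lemma reflp_intertwined_le: "reflp (intertwined_le P Opens)"
  by (simp add: reflp_def intertwined_le_def)

lemma transp_intertwined_le: "transp (intertwined_le P Opens)"
  by (auto simp: transp_def intertwined_le_def)

lemma intertwined_le_if_in_open_subset:
  assumes U: "U \<in> Opens" "U \<subseteq> intertwined_set P Opens p" and q: "q \<in> U"
  shows "intertwined_le P Opens q p"
  unfolding intertwined_le_def
proof
  fix r assume r: "r \<in> intertwined_set P Opens q"
  have "V \<inter> W \<noteq> {}" if "V \<in> Opens" "W \<in> Opens" "p \<in> V" "r \<in> W" for V W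
  proof -
    have "U \<inter> W \<noteq> {}"
      using r q U(1) that(2,4) by (simp add: intertwined_set_def intertwined_def)
    then obtain y where "y \<in> W" "intertwined Opens p y"
      using U(2) by (auto simp: intertwined_set_def)
    with that show ?thesis
      by (simp add: intertwined_def)
  qed
  with r show "r \<in> intertwined_set P Opens p"
    by (simp add: intertwined_set_def intertwined_def)
qed

lemma community_subset_intertwined_set: "community P Opens p \<subseteq> intertwined_set P Opens p"
  unfolding community_def by (rule semi_interior_subset)

lemma community_subset: "community P Opens p \<subseteq> P"
  using community_subset_intertwined_set[of P Opens p] by (auto simp: intertwined_set_def)

lemma community_mono:
  "intertwined_le P Opens p q \<Longrightarrow> community P Opens p \<subseteq> community P Opens q"
  unfolding intertwined_le_def community_def by (rule semi_interior_mono)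

lemma intertwined_le_if_in_community:
  "q \<in> community P Opens p \<Longrightarrow> intertwined_le P Opens q p"
  by (auto simp: community_def semi_interior_def intro: intertwined_le_if_in_open_subset)

lemma intertwined_set_eq_if_in_community_of_minimal:
  assumes "minimal_wrt (intertwined_le P Opens) P m" and q: "q \<in> community P Opens m"
  shows "intertwined_set P Opens q = intertwined_set P Opens m"
proof -
  have "q \<in> P" "intertwined_le P Opens q m"
    using q by (rule community_subset[THEN subsetD], rule intertwined_le_if_in_community)
  with assms(1) show ?thesis
    by (auto simp: minimal_wrt_def intertwined_le_def)
qed

lemma regular_point_if_in_community_of_minimal:
  assumes "semitopology P Opens" and "minimal_wrt (intertwined_le P Opens) P m"
    and q: "q \<in> community P Opens m"
  shows "regular_point P Opens q"
proof -
  note same_intertwined_set = intertwined_set_eq_if_in_community_of_minimal[OF assms(2)]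
  have "community P Opens q = community P Opens m"
    using same_intertwined_set[OF q] by (simp add: community_def)
  moreover have "community P Opens m \<in> Opens"
    unfolding community_def using assms(1) by (rule semi_interior_open)
  moreover have "intertwined Opens x y"
    if "x \<in> community P Opens m" "y \<in> community P Opens m" for x y
  proof -
    have "y \<in> intertwined_set P Opens x"
      using that(2) same_intertwined_set[OF that(1)] community_subset_intertwined_set[of P Opens m]
      by blast
    then show ?thesis by (simp add: intertwined_set_def)
  qed
  ultimately show ?thesis
    using q by (auto simp: regular_point_def transitive_set_iff_pairwise_intertwined)
qed

lemma intertwined_complete_chain_bounded:
  assumes "intertwined_complete P Opens"
    and "C \<subseteq> P" "Complete_Partial_Order.chain (intertwined_le P Opens) C"
  shows "\<exists>b\<in>P. \<forall>c\<in>C. intertwined_le P Opens b c"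
proof -
  obtain b where "b \<in> P" and "intertwined_set P Opens b \<subseteq> (\<Inter>c\<in>C. intertwined_set P Opens c)"
    using assms unfolding intertwined_complete_def by blast
  then show ?thesis
    unfolding intertwined_le_def by blast
qed

lemma intertwined_complete_nonempty:
  assumes "intertwined_complete P Opens"
  shows "P \<noteq> {}"
  using intertwined_complete_chain_bounded[OF assms, of "{}"] by (auto simp: chain_def)

lemma intertwined_complete_minimal_below:
  assumes "intertwined_complete P Opens" and "p \<in> P"
  obtains m where "minimal_wrt (intertwined_le P Opens) P m" and "intertwined_le P Opens m p"
proof (rule preorder_minimal_below_if_chains_bounded[of P "intertwined_le P Opens" p])
  show "reflp_on P (intertwined_le P Opens)"
    using reflp_intertwined_le by (rule reflp_on_subset) simp
  show "transp_on P (intertwined_le P Opens)"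
    using transp_intertwined_le by (rule transp_on_subset) simp
  show "\<exists>b\<in>P. \<forall>c\<in>C. intertwined_le P Opens b c"
    if "C \<subseteq> P" "Complete_Partial_Order.chain (intertwined_le P Opens) C" for C
    using assms(1) that by (rule intertwined_complete_chain_bounded)
qed (use assms(2) that in simp_all)

theorem theorem6p18:
  fixes P :: "'a set" and Opens :: "'a set set"
  assumes "semitopology P Opens"
    and "intertwined_complete P Opens"
    and "quasiregular P Opens"
  shows "(\<forall>p\<in>P. \<exists>q\<in>community P Opens p. regular_point P Opens q) \<and>
         (\<exists>q\<in>P. regular_point P Opens q)"
proof -
  have regular_in_community: "\<exists>q\<in>community P Opens p. regular_point P Opens q" if "p \<in> P" for p
  proof -
    obtain m where minimal: "minimal_wrt (intertwined_le P Opens) P m"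
      and "intertwined_le P Opens m p"
      using intertwined_complete_minimal_below[OF assms(2) \<open>p \<in> P\<close>] .
    obtain q where "q \<in> community P Opens m"
      using assms(3) minimal
      unfolding quasiregular_def quasiregular_point_def minimal_wrt_def by blast
    moreover from this have "regular_point P Opens q"
      by (rule regular_point_if_in_community_of_minimal[OF assms(1) minimal])
    ultimately show ?thesis
      using community_mono[OF \<open>intertwined_le P Opens m p\<close>] by blast
  qed
  moreover obtain p where "p \<in> P"
    using intertwined_complete_nonempty[OF assms(2)] by blast
  ultimately show ?thesis
    using community_subset[of P Opens p] by blast
qed

end
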